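(* Let $(M,\mathrm{dist})$ be a compact metric space endowed with a finite Borel measure $\mu$ such that $\mu(U)>0$ for every nonempty open set $U\subset M$, and let $f\colon M\to M$ be a homeomorphism which is transitive, i.e. there exists $r\in M$ with $\overline{\{f^n(r): n\ge 0\}}=M$. Then exactly one of the following alternatives holds (at least one holds): (i) $f$ has the shadowing property; (ii) $f$ is absolutely not shadowable, i.e. there exists $\varepsilon>0$ such that $p(y_0,d,\varepsilon)=0$ for every $y_0\in M$ and every $d>0$.
   Context: For $a>0$ and $x\in M$, $B(a,x)$ denotes the open ball of radius $a$ centered at $x$. For $d>0$, a sequence $\{y_n\}_{n\ge 0}$ (or finite $\{y_n\}_{n=0}^N$) in $M$ is a $d$-pseudotrajectory if $\mathrm{dist}(y_{n+1},f(y_n))\le d$ for all admissible $n$. It is $\varepsilon$-shadowed if there is $x_0\in M$ with $\mathrm{dist}(y_n,f^n(x_0))\le\varepsilon$ for all admissible $n$. The map $f$ has the shadowing property if for every $\varepsilon>0$ there exists $d>0$ such that every $d$-pseudotrajectory $\{y_n\}_{n\ge0}$ can be $\varepsilon$-shadowed. Random pseudotrajectories: for $y_0\in M$ and $d>0$, let $\Omega(y_0,d)$ be the set of all infinite $d$-pseudotrajectories starting at $y_0$, equipped with the probability measure $P^{y_0,d}$ of the Markov chain starting at $y_0$ with transition law: given $y_n$, the point $y_{n+1}$ is chosen uniformly in $B(d,f(y_n))$ with respect to $\mu$, i.e. $P(y_{n+1}\in A\mid y_n)=\mu(A\cap B(d,f(y_n)))/\mu(B(d,f(y_n)))$ for measurable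 $A\subset M$. For $\varepsilon>0$, $Sh(y_0,d,\varepsilon)\subset\Omega(y_0,d)$ is the (measurable) set of pseudotrajectories that can be $\varepsilon$-shadowed, and $p(y_0,d,\varepsilon)=P^{y_0,d}(Sh(y_0,d,\varepsilon))$. *)

theory Defs
  imports "HOL-Probability.Probability"
begin

definition pseudotraj :: "('a::metric_space \<Rightarrow> 'a) \<Rightarrow> real \<Rightarrow> (nat \<Rightarrow> 'a) \<Rightarrow> bool" where
  "pseudotraj f d y \<longleftrightarrow> (\<forall>n. dist (y (Suc n)) (f (y n)) \<le> d)"

definition shadowed :: "('a::metric_space \<Rightarrow> 'a) \<Rightarrow> real \<Rightarrow> (nat \<Rightarrow> 'a) \<Rightarrow> bool" where
  "shadowed f \<epsilon> y \<longleftrightarrow> (\<exists>x0. \<forall>n. dist (y n) ((f ^^ n) x0) \<le> \<epsilon>)"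

definition shadowing_property :: "('a::metric_space \<Rightarrow> 'a) \<Rightarrow> bool" where
  "shadowing_property f \<longleftrightarrow>
     (\<forall>\<epsilon>>0. \<exists>d>0. \<forall>y. pseudotraj f d y \<longrightarrow> shadowed f \<epsilon> y)"

text \<open>Transition kernel of the random pseudotrajectory Markov chain, in the
  format of the Ionescu-Tulcea construction of HOL-Probability: coordinate 0 is
  the Dirac measure at y0, and given the history \<omega> (coordinates 0..n) the
  coordinate n+1 is uniformly distributed (w.r.t. \<mu>) on the open ball B(d, f(\<omega> n)).\<close>
definition rp_kernel ::
  "'a::metric_space measure \<Rightarrow> ('a \<Rightarrow> 'a) \<Rightarrow> real \<Rightarrow> 'a \<Rightarrow> nat \<Rightarrow> (nat \<Rightarrow> 'a) \<Rightarrow> 'a measure" where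
  "rp_kernel \<mu> f d y0 i \<omega> =
     (case i of 0 \<Rightarrow> return borel y0
              | Suc n \<Rightarrow> uniform_measure \<mu> (ball (f (\<omega> n)) d))"

definition rp_measure ::
  "'a::metric_space measure \<Rightarrow> ('a \<Rightarrow> 'a) \<Rightarrow> real \<Rightarrow> 'a \<Rightarrow> (nat \<Rightarrow> 'a) measure" where
  "rp_measure \<mu> f d y0 =
     projective_family.lim UNIV (Ionescu_Tulcea.CI (rp_kernel \<mu> f d y0) (\<lambda>_. borel)) (\<lambda>_. borel)"

definition Omega_pt :: "('a::metric_space \<Rightarrow> 'a) \<Rightarrow> 'a \<Rightarrow> real \<Rightarrow> (nat \<Rightarrow> 'a) set" where
  "Omega_pt f y0 d = {y. y 0 = y0 \<and> pseudotraj f d y}"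

definition Sh :: "('a::metric_space \<Rightarrow> 'a) \<Rightarrow> 'a \<Rightarrow> real \<Rightarrow> real \<Rightarrow> (nat \<Rightarrow> 'a) set" where
  "Sh f y0 d \<epsilon> = {y \<in> Omega_pt f y0 d. shadowed f \<epsilon> y}"

definition p_shadow :: "'a::metric_space measure \<Rightarrow> ('a \<Rightarrow> 'a) \<Rightarrow> 'a \<Rightarrow> real \<Rightarrow> real \<Rightarrow> real" where
  "p_shadow \<mu> f y0 d \<epsilon> = measure (rp_measure \<mu> f d y0) (Sh f y0 d \<epsilon>)"

definition absolutely_not_shadowable :: "'a::metric_space measure \<Rightarrow> ('a \<Rightarrow> 'a) \<Rightarrow> bool" where
  "absolutely_not_shadowable \<mu> f \<longleftrightarrow>
     (\<exists>\<epsilon>>0. \<forall>y0. \<forall>d>0. p_shadow \<mu> f y0 d \<epsilon> = 0)"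

end

theory Submission
  imports Defs
begin

text \<open>If shadowing fails at scale \<open>\<epsilon>\<close>, then for every \<open>d\<close> some finite \<open>d/2\<close>-pseudotrajectory is not
  \<open>\<epsilon>\<close>-shadowed. By transitivity and compactness it can be reached by a \<open>d/2\<close>-pseudotrajectory of
  bounded length from any point, and the random walk stays close to this path with a probability
  bounded below uniformly in the starting point, since balls of fixed radius have measure
  bounded below. Hence the probability of avoiding all such paths during \<open>k\<close> consecutive blocks of
  time decays geometrically in \<open>k\<close>, while a trajectory that follows one of them within \<open>\<epsilon>/2\<close> is
  not \<open>\<epsilon>/2\<close>-shadowed. Conversely, under shadowing almost every random pseudotrajectory is
  shadowed as soon as \<open>d\<close> is small.\<close>

section \<open>Paths that cannot be shadowed\<close>

lemma continuous_on_funpow: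
  fixes f :: "'a::topological_space \<Rightarrow> 'a"
  assumes "continuous_on UNIV f"
  shows "continuous_on UNIV (f ^^ n)"
proof (induction n)
  case 0
  show ?case by (simp add: continuous_on_id)
next
  case (Suc n)
  then show ?case
    using continuous_on_compose[OF Suc] continuous_on_subset[OF assms] by auto
qed

text \<open>For each \<open>n\<close> the points whose orbit is \<epsilon>-close to \<open>y\<close>
  at time \<open>n\<close> form a closed set. If finitely many of these sets always met, compactness
  would give a shadowing point.\<close>

lemma not_shadowed_finite:
  fixes f :: "'a::metric_space \<Rightarrow> 'a"
  assumes compact: "compact (UNIV :: 'a set)" and cont: "continuous_on UNIV f"
    and ns: "\<not> shadowed f \<epsilon> y"
  obtains m where "\<And>x. \<exists>n\<le>m. dist (y n) ((f ^^ n) x) > \<epsilon>"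
proof -
  define K where "K n = {x. dist (y n) ((f ^^ n) x) \<le> \<epsilon>}" for n
  have closed: "closed (K n)" for n
    unfolding K_def
    by (intro closed_Collect_le continuous_intros continuous_on_funpow cont)
  have "\<exists>m. \<forall>x. \<exists>n\<le>m. dist (y n) ((f ^^ n) x) > \<epsilon>"
  proof (rule ccontr)
    assume neg: "\<nexists>m. \<forall>x. \<exists>n\<le>m. dist (y n) ((f ^^ n) x) > \<epsilon>"
    have "UNIV \<inter> (\<Inter>n\<in>UNIV. K n) \<noteq> {}"
    proof (rule compact_imp_fip_image[OF compact])
      fix I :: "nat set"
      assume "finite I"
      from neg obtain x where "\<forall>n\<le>Max (insert 0 I). dist (y n) ((f ^^ n) x) \<le> \<epsilon>"
        by (meson not_le)
      with \<open>finite I\<close> have "x \<in> (\<Inter>n\<in>I. K n)"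
        by (auto simp: K_def)
      then show "UNIV \<inter> (\<Inter>n\<in>I. K n) \<noteq> {}" by blast
    qed (use closed in auto)
    then show False
      using ns by (auto simp: shadowed_def K_def)
  qed
  then show ?thesis using that by blast
qed

text \<open>Surjectivity gives a preimage of \<open>x\<close> under \<open>f ^^ k\<close>; an orbit
  point near that preimage is carried by the continuous map \<open>f ^^ k\<close> to one near
  \<open>x\<close>, at a time at least \<open>k\<close>.\<close>

lemma orbit_tail_dense:
  fixes f :: "'a::metric_space \<Rightarrow> 'a"
  assumes cont: "continuous_on UNIV f" and surj: "surj f"
    and dense: "closure {(f ^^ n) r | n. True} = UNIV" and "e > 0"
  shows "\<exists>n\<ge>k. dist ((f ^^ n) r) x < e"
proof -
  obtain z where z: "(f ^^ k) z = x"
    using surj_fn[OF surj] by (metis surj_def)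
  obtain \<delta> where "\<delta> > 0" and \<delta>: "\<And>u. dist u z < \<delta> \<Longrightarrow> dist ((f ^^ k) u) ((f ^^ k) z) < e"
    using continuous_on_funpow[OF cont, of k] \<open>e > 0\<close>
    by (metis UNIV_I continuous_on_iff)
  have "z \<in> closure {(f ^^ n) r | n. True}"
    using dense by simp
  then obtain n where "dist ((f ^^ n) r) z < \<delta>"
    unfolding closure_approachable using \<open>\<delta> > 0\<close> by auto
  then have "dist ((f ^^ (k + n)) r) x < e"
    using \<delta> z by (simp add: funpow_add)
  then show ?thesis by (metis le_add1)
qed

text \<open>Every bad path first runs along the transitive orbit until it meets a pseudotrajectory
  that cannot be shadowed, and then follows the latter; by compactness finitely many starting
  points on the orbit serve all of the space.\<close>

lemma bad_paths:
  fixes f :: "'a::metric_space \<Rightarrow> 'a"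
  assumes compact: "compact (UNIV :: 'a set)" and cont: "continuous_on UNIV f"
    and surj: "surj f" and dense: "closure {(f ^^ n) r | n. True} = UNIV"
    and "\<delta> > 0" and z: "pseudotraj f \<delta> z" and ns: "\<not> shadowed f \<epsilon> z"
  obtains W :: "(nat \<Rightarrow> 'a) set" and L where "finite W"
    "\<And>x. \<exists>w\<in>W. dist x (w 0) < \<delta>"
    "\<And>w i. w \<in> W \<Longrightarrow> dist (f (w i)) (w (Suc i)) \<le> \<delta>"
    "\<And>w x. w \<in> W \<Longrightarrow> \<exists>i<L. dist (w i) ((f ^^ i) x) > \<epsilon>"
proof -
  obtain m where m: "\<And>x. \<exists>n\<le>m. dist (z n) ((f ^^ n) x) > \<epsilon>"
    using not_shadowed_finite[OF compact cont ns] by blast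
  have "UNIV \<subseteq> (\<Union>n. ball ((f ^^ n) r) \<delta>)"
    using orbit_tail_dense[OF cont surj dense \<open>\<delta> > 0\<close>, of 0] by auto
  then obtain N where N: "finite N" "UNIV \<subseteq> (\<Union>n\<in>N. ball ((f ^^ n) r) \<delta>)"
    using compactE_image[OF compact, of UNIV "\<lambda>n. ball ((f ^^ n) r) \<delta>"] by auto
  \<comment> \<open>Choosing \<open>p\<close> beyond every index in \<open>N\<close> gives each path
    a nonempty stretch of orbit before it jumps to \<open>z 0\<close>.\<close>
  obtain p where p: "p \<ge> Suc (Max (insert 0 N))" "dist ((f ^^ p) r) (z 0) < \<delta>"
    using orbit_tail_dense[OF cont surj dense \<open>\<delta> > 0\<close>] by blast
  have Np: "n < p" if "n \<in> N" for n
    using p(1) N(1) that by (auto simp: Suc_le_eq)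
  define w where "w n i = (if n + i < p then (f ^^ (n + i)) r else z (n + i - p))" for n i
  show ?thesis
  proof
    show "finite (w ` N)" using N by simp
    show "\<exists>w\<in>w ` N. dist x (w 0) < \<delta>" for x
    proof -
      obtain n where "n \<in> N" "x \<in> ball ((f ^^ n) r) \<delta>"
        using N(2) by blast
      then show ?thesis
        using Np by (auto simp: w_def dist_commute)
    qed
    show "dist (f (v i)) (v (Suc i)) \<le> \<delta>" if "v \<in> w ` N" for v i
    proof -
      obtain n where n: "n \<in> N" "v = w n" using \<open>v \<in> w ` N\<close> by blast
      consider "Suc (n + i) < p" | "Suc (n + i) = p" | "p \<le> n + i" by linarith
      then show ?thesis
      proof cases
        case 1
        then show ?thesis using \<open>\<delta> > 0\<close> by (simp add: n w_def)
      next
        case 2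
        then have "f ((f ^^ (n + i)) r) = (f ^^ p) r" by auto
        then show ?thesis using 2 p by (simp add: n w_def)
      next
        case 3
        then show ?thesis
          using z by (simp add: n w_def pseudotraj_def dist_commute Suc_diff_le)
      qed
    qed
    show "\<exists>i<p + Suc m. dist (v i) ((f ^^ i) x) > \<epsilon>" if "v \<in> w ` N" for v x
    proof -
      obtain n where n: "n \<in> N" "v = w n" using \<open>v \<in> w ` N\<close> by blast
      \<comment> \<open>The path \<open>w n\<close> reaches \<open>z 0\<close> at time
        \<open>p - n\<close>, so an orbit close to it would make the point
        \<open>(f ^^ (p - n)) x\<close> follow \<open>z\<close> up to time \<open>m\<close>.\<close>
      obtain j where j: "j \<le> m" "dist (z j) ((f ^^ j) ((f ^^ (p - n)) x)) > \<epsilon>"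
        using m by blast
      moreover have "(f ^^ (p - n + j)) x = (f ^^ j) ((f ^^ (p - n)) x)"
        by (simp add: funpow_add add.commute)
      ultimately have "dist (v (p - n + j)) ((f ^^ (p - n + j)) x) > \<epsilon>"
        using Np[OF n(1)] by (simp add: n w_def)
      then show ?thesis using j by (intro exI[of _ "p - n + j"]) auto
    qed
  qed
qed

text \<open>Finitely many balls of radius \<open>\<eta> / 2\<close> cover the space, and every ball
  of radius \<eta> contains one of them; the least of their masses serves as
  \<open>b\<close>.\<close>

lemma compact_ball_measure_lower_bound:
  fixes \<mu> :: "'a::metric_space measure"
  assumes compact: "compact (UNIV :: 'a set)" and sets: "sets \<mu> = sets borel"
    and fin: "finite_measure \<mu>"
    and full_support: "\<And>U. open U \<Longrightarrow> U \<noteq> {} \<Longrightarrow> emeasure \<mu> U > 0" and "\<eta> > 0"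
  obtains b :: real where "b > 0" "\<And>x. b \<le> measure \<mu> (ball x \<eta>)"
proof -
  interpret finite_measure \<mu> by fact
  have "UNIV \<subseteq> (\<Union>x::'a. ball x (\<eta> / 2))"
    using \<open>\<eta> > 0\<close> by auto
  then obtain D where D: "finite D" "UNIV \<subseteq> (\<Union>x\<in>D. ball (x::'a) (\<eta> / 2))"
    using compactE_image[OF compact, of UNIV "\<lambda>x. ball x (\<eta> / 2)"] by auto
  then have "D \<noteq> {}" by auto
  define b where "b = Min ((\<lambda>x. measure \<mu> (ball x (\<eta> / 2))) ` D)"
  show ?thesis
  proof
    have "measure \<mu> (ball x (\<eta> / 2)) > 0" for x
      using full_support[of "ball x (\<eta> / 2)"] \<open>\<eta> > 0\<close> by (simp add: emeasure_eq_measure)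
    then show "b > 0"
      unfolding b_def using D \<open>D \<noteq> {}\<close> by simp
    fix x
    obtain c where c: "c \<in> D" "x \<in> ball c (\<eta> / 2)" using D by blast
    have "b \<le> measure \<mu> (ball c (\<eta> / 2))"
      unfolding b_def using c D by simp
    also have "\<dots> \<le> measure \<mu> (ball x \<eta>)"
    proof (rule finite_measure_mono)
      show "ball c (\<eta> / 2) \<subseteq> ball x \<eta>"
      proof
        fix u
        assume "u \<in> ball c (\<eta> / 2)"
        then show "u \<in> ball x \<eta>"
          using c dist_triangle[of x u c] by (auto simp: dist_commute)
      qed
    qed (simp add: sets)
    finally show "b \<le> measure \<mu> (ball x \<eta>)" .
  qed
qed

section \<open>Measurability and the Markov chain\<close>

text \<open>Without the class \<open>second_countable_topology\<close>, the distance is not known to be measurable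
  on the product of the Borel spaces; the infimum over a countable dense set replaces it.\<close>

lemma borel_measurable_dist_compact:
  fixes g h :: "'b \<Rightarrow> 'a::metric_space"
  assumes compact: "compact (UNIV :: 'a set)"
    and [measurable]: "g \<in> borel_measurable N" "h \<in> borel_measurable N"
  shows "(\<lambda>x. dist (g x) (h x)) \<in> borel_measurable N"
proof -
  \<comment> \<open>Total boundedness yields finite nets of mesh \<open>1 / Suc n\<close>; their
    union is the countable dense set.\<close>
  have "\<exists>k. finite k \<and> (UNIV :: 'a set) \<subseteq> (\<Union>x\<in>k. ball x (1 / Suc n))" for n
    using seq_compact_imp_totally_bounded[OF compact_imp_seq_compact[OF compact]]
    by auto
  then obtain k where k: "\<And>n. finite (k n)" "\<And>n. (UNIV :: 'a set) \<subseteq> (\<Union>x\<in>k n. ball x (1 / Suc n))"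
    by metis
  define D where "D = (\<Union>n. k n)"
  have "countable D"
    unfolding D_def using countable_finite[OF k(1)] by simp
  have dense: "\<exists>c\<in>D. dist a c < e" if "e > 0" for a e
  proof -
    obtain n where "1 / Suc n < e"
      using nat_approx_posE[OF \<open>e > 0\<close>] by blast
    moreover obtain c where "c \<in> k n" "a \<in> ball c (1 / Suc n)"
      using k(2)[of n] by blast
    ultimately show ?thesis
      by (intro bexI[of _ c]) (auto simp: D_def dist_commute)
  qed
  then have "D \<noteq> {}"
    using zero_less_one by blast
  have bdd: "bdd_below ((\<lambda>c. dist a c + dist b c) ` D)" for a b
    by (rule bdd_belowI2[where m=0]) simp
  have eq: "dist a b = (INF c\<in>D. dist a c + dist b c)" for a b
  proof (rule antisym)
    show "dist a b \<le> (INF c\<in>D. dist a c + dist b c)"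
      by (rule cINF_greatest[OF \<open>D \<noteq> {}\<close>]) (metis dist_triangle2)
    show "(INF c\<in>D. dist a c + dist b c) \<le> dist a b"
    proof (rule field_le_epsilon)
      fix e :: real
      assume "e > 0"
      \<comment> \<open>The distance from \<open>a\<close> to \<open>c\<close> enters twice when
        \<open>dist b c\<close> is bounded through \<open>a\<close>, hence
        \<open>e / 2\<close>.\<close>
      then obtain c where c: "c \<in> D" "dist a c < e / 2"
        using dense[of "e / 2"] by auto
      have "(INF c\<in>D. dist a c + dist b c) \<le> dist a c + dist b c"
        by (rule cINF_lower[OF bdd c(1)])
      also have "\<dots> \<le> dist a b + e"
        using c(2) dist_triangle[of b c a] by (simp add: dist_commute)
      finally show "(INF c\<in>D. dist a c + dist b c) \<le> dist a b + e" .
    qed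
  qed
  have "(\<lambda>x. INF c\<in>D. dist (g x) c + dist (h x) c) \<in> borel_measurable N"
  proof (rule borel_measurable_cINF[OF \<open>countable D\<close>])
    fix c :: 'a
    have [measurable]: "(\<lambda>a. dist a c) \<in> borel_measurable borel"
      by (intro borel_measurable_continuous_onI continuous_intros)
    show "(\<lambda>x. dist (g x) c + dist (h x) c) \<in> borel_measurable N"
      by measurable
  qed (rule bdd)
  then show ?thesis unfolding eq[symmetric] .
qed

section \<open>Composition of kernels and finite-dimensional laws in the Ionescu-Tulcea
  construction\<close>

context Ionescu_Tulcea
begin

text \<open>The Chapman-Kolmogorov equation: the history after \<open>m\<close> steps is the
  starting point of the remaining \<open>l\<close> steps.\<close>

lemma emeasure_C_add:
  assumes \<omega>: "\<omega> \<in> space (PiM {0..<n} M)" and A: "A \<in> sets (PiM {0..<n + m + l} M)"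
  shows "emeasure (C n (m + l) \<omega>) A = (\<integral>\<^sup>+x. emeasure (C (n + m) l x) A \<partial>C n m \<omega>)"
  unfolding split_C[OF \<omega>, symmetric]
proof (rule emeasure_bind[OF _ _ A])
  show "space (C n m \<omega>) \<noteq> {}"
    by (rule prob_space.not_empty[OF prob_space_C[OF \<omega>]])
  show "C (n + m) l \<in> measurable (C n m \<omega>) (subprob_algebra (PiM {0..<n + m + l} M))"
    unfolding measurable_cong_sets[OF sets_C[OF \<omega>] refl] by (rule measurable_C)
qed

lemma emeasure_C_Suc:
  assumes \<omega>: "\<omega> \<in> space (PiM {0..<n} M)" and A: "A \<in> sets (PiM {0..<Suc (n + m)} M)"
  shows "emeasure (C n (Suc m) \<omega>) A = (\<integral>\<^sup>+x. emeasure (eP (n + m) x) A \<partial>C n m \<omega>)"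
  unfolding C.simps
proof (rule emeasure_bind[OF _ _ A])
  show "space (C n m \<omega>) \<noteq> {}"
    by (rule prob_space.not_empty[OF prob_space_C[OF \<omega>]])
  show "eP (n + m) \<in> measurable (C n m \<omega>) (subprob_algebra (PiM {0..<Suc (n + m)} M))"
    unfolding measurable_cong_sets[OF sets_C[OF \<omega>] refl] by (rule measurable_eP)
qed

text \<open>The whole space is the cylinder over the empty set of coordinates, where the projective
  family has mass one.\<close>

lemma prob_space_lim: "prob_space PF.lim"
proof
  have "PF.emb UNIV {} (space (PiM {} M)) = space PF.lim"
    by (auto simp: space_PiM prod_emb_def restrict_def)
  then show "emeasure PF.lim (space PF.lim) = 1"
    using lim[of "{}" "space (PiM {} M)"] prob_space.emeasure_space_1[OF PF.prob_space_P[of "{}"]]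
    by (simp add: PF.space_P)
qed

text \<open>Identifies the law of the first \<open>n\<close> coordinates;
  \<open>\<lambda>_. undefined\<close> is the empty history, the only point of the empty
  product.\<close>

lemma emeasure_lim_initial:
  assumes "A \<in> sets (PiM {0..<n} M)"
  shows "emeasure PF.lim (PF.emb UNIV {0..<n} A) = emeasure (C 0 n (\<lambda>_. undefined)) A"
  using assms sets.sets_into_space[OF assms]
  by (subst lim) (auto simp: emeasure_CI[of _ n] prod_emb_id space_PiM)

end

section \<open>The random pseudotrajectory as an Ionescu-Tulcea process\<close>

locale random_pseudotrajectory =
  fixes \<mu> :: "'a::metric_space measure" and f :: "'a \<Rightarrow> 'a" and d :: real and y0 :: 'a
  assumes compact_M: "compact (UNIV :: 'a set)"
    and sets_mu: "sets \<mu> = sets borel"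
    and finite_mu: "finite_measure \<mu>"
    and full_support: "\<And>U. open U \<Longrightarrow> U \<noteq> {} \<Longrightarrow> emeasure \<mu> U > 0"
    and cont: "continuous_on UNIV f"
    and d_pos: "d > 0"
begin

sublocale mu: finite_measure \<mu>
  by (rule finite_mu)

lemma measurable_f [measurable]: "f \<in> borel_measurable borel"
  using cont by (rule borel_measurable_continuous_onI)

lemma emeasure_ball_pos: "emeasure \<mu> (ball x d) > 0"
  using d_pos by (intro full_support) auto

lemma prob_space_rp_kernel: "prob_space (rp_kernel \<mu> f d y0 i \<omega>)"
  using emeasure_ball_pos[of "f (\<omega> (i - 1))"]
  by (cases i) (auto simp: rp_kernel_def intro!: prob_space_return prob_space_uniform_measure)

lemma sets_rp_kernel: "sets (rp_kernel \<mu> f d y0 i \<omega>) = sets borel"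
  by (cases i) (simp_all add: rp_kernel_def sets_mu)

text \<open>The sets \<open>ball x d \<inter> A\<close> are the sections of one measurable subset of
  the product, and the mass of a section under a finite measure depends measurably on
  \<open>x\<close>.\<close>

lemma measurable_emeasure_Int_ball:
  assumes [measurable]: "A \<in> sets borel"
  shows "(\<lambda>x. emeasure \<mu> (ball x d \<inter> A)) \<in> borel_measurable borel"
proof -
  have sets_eq [measurable_cong]: "sets \<mu> = sets borel" by (rule sets_mu)
  have [measurable]: "(\<lambda>p. dist (fst p) (snd p)) \<in> borel_measurable (borel \<Otimes>\<^sub>M \<mu>)"
    by (rule borel_measurable_dist_compact[OF compact_M]) measurable
  have "{p \<in> space (borel \<Otimes>\<^sub>M \<mu>). dist (fst p) (snd p) < d \<and> snd p \<in> A} \<in> sets (borel \<Otimes>\<^sub>M \<mu>)"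
    by measurable
  from mu.measurable_emeasure_Pair[OF this] show ?thesis
    by (rule measurable_cong[THEN iffD1, rotated])
       (auto simp: space_pair_measure sets_eq_imp_space_eq[OF sets_mu] intro!: arg_cong[where f="emeasure \<mu>"])
qed

lemma measurable_rp_kernel:
  "rp_kernel \<mu> f d y0 i \<in> measurable (PiM {0..<i} (\<lambda>_. borel)) (subprob_algebra borel)"
proof (rule measurable_subprob_algebra)
  show "subprob_space (rp_kernel \<mu> f d y0 i \<omega>)" for \<omega>
    by (rule prob_space_imp_subprob_space[OF prob_space_rp_kernel])
  show "sets (rp_kernel \<mu> f d y0 i \<omega>) = sets borel" for \<omega>
    by (rule sets_rp_kernel)
  fix A :: "'a set"
  assume A: "A \<in> sets borel"
  show "(\<lambda>\<omega>. emeasure (rp_kernel \<mu> f d y0 i \<omega>) A) \<in> borel_measurable (PiM {0..<i} (\<lambda>_. borel))"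
  proof (cases i)
    case 0
    then show ?thesis by (simp add: rp_kernel_def)
  next
    case (Suc n)
    \<comment> \<open>The instance for the whole space handles the normalising denominator.\<close>
    note [measurable] = measurable_emeasure_Int_ball[OF A] measurable_emeasure_Int_ball[OF sets.top]
    have [measurable]: "(\<lambda>\<omega>. \<omega> n) \<in> measurable (PiM {0..<i} (\<lambda>_. borel)) borel"
      using Suc by (intro measurable_component_singleton) auto
    have "(\<lambda>\<omega>. emeasure \<mu> (ball (f (\<omega> n)) d \<inter> A) / emeasure \<mu> (ball (f (\<omega> n)) d \<inter> space borel))
        \<in> borel_measurable (PiM {0..<i} (\<lambda>_. borel))"
      by measurable
    then show ?thesis
      using A by (simp add: Suc rp_kernel_def sets_mu)
  qed
qed

sublocale Ionescu_Tulcea "rp_kernel \<mu> f d y0" "\<lambda>_. borel"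
  by (rule Ionescu_Tulcea.intro) (rule measurable_rp_kernel prob_space_rp_kernel)+

lemma rp_measure_eq: "rp_measure \<mu> f d y0 = PF.lim"
  by (simp add: rp_measure_def)

lemma emeasure_rp_kernel_Suc:
  assumes "A \<in> sets borel"
  shows "emeasure (rp_kernel \<mu> f d y0 (Suc n) \<omega>) A
    = emeasure \<mu> (ball (f (\<omega> n)) d \<inter> A) / emeasure \<mu> (ball (f (\<omega> n)) d)"
  using assms by (simp add: rp_kernel_def sets_mu)

text \<open>Replacing the mass of the transition ball by the total mass makes the bound independent
  of the history.\<close>

lemma emeasure_rp_kernel_ball_ge:
  assumes "ball w \<eta> \<subseteq> ball (f (\<omega> n)) d"
  shows "emeasure (rp_kernel \<mu> f d y0 (Suc n) \<omega>) (ball w \<eta>)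
    \<ge> ennreal (measure \<mu> (ball w \<eta>) / measure \<mu> UNIV)"
proof -
  have pos: "measure \<mu> (ball (f (\<omega> n)) d) > 0"
    using emeasure_ball_pos[of "f (\<omega> n)"] by (simp add: mu.emeasure_eq_measure)
  have le: "measure \<mu> (ball (f (\<omega> n)) d) \<le> measure \<mu> UNIV"
    by (intro mu.finite_measure_mono) (auto simp: sets_mu)
  have "emeasure (rp_kernel \<mu> f d y0 (Suc n) \<omega>) (ball w \<eta>)
      = emeasure \<mu> (ball w \<eta>) / emeasure \<mu> (ball (f (\<omega> n)) d)"
    using assms by (simp add: emeasure_rp_kernel_Suc inf.absorb2)
  also have "\<dots> = ennreal (measure \<mu> (ball w \<eta>) / measure \<mu> (ball (f (\<omega> n)) d))"
    using pos by (simp add: mu.emeasure_eq_measure divide_ennreal)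
  also have "\<dots> \<ge> ennreal (measure \<mu> (ball w \<eta>) / measure \<mu> UNIV)"
    using pos le by (intro ennreal_leI divide_left_mono) auto
  finally show ?thesis .
qed

section \<open>Following a bad path, and geometric decay of the probability of avoiding all of
  them\<close>

definition follow :: "nat \<Rightarrow> real \<Rightarrow> (nat \<Rightarrow> 'a) \<Rightarrow> nat \<Rightarrow> (nat \<Rightarrow> 'a) \<Rightarrow> bool" where
  "follow L \<eta> w n x \<longleftrightarrow> (\<forall>i<L. dist (w i) (x (n + i)) < \<eta>)"

lemma follow_measurable:
  assumes "n + L \<le> N"
  shows "Measurable.pred (PiM {0..<N} (\<lambda>_. borel)) (follow L \<eta> w n)"
proof -
  have [measurable]: "Measurable.pred (PiM {0..<N} (\<lambda>_. borel)) (\<lambda>x. dist (w i) (x (n + i)) < \<eta>)"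
    if "i < L" for i
  proof -
    have [measurable]: "(\<lambda>x. x (n + i)) \<in> measurable (PiM {0..<N} (\<lambda>_. borel)) borel"
      using that assms by (intro measurable_component_singleton) auto
    have [measurable]: "(\<lambda>a. dist (w i) a) \<in> borel_measurable borel"
      by (intro borel_measurable_continuous_onI continuous_intros)
    show ?thesis by measurable
  qed
  have "Measurable.pred (PiM {0..<N} (\<lambda>_. borel)) (\<lambda>x. \<forall>i\<in>{..<L}. dist (w i) (x (n + i)) < \<eta>)"
    by (intro pred_intros_finite) auto
  then show ?thesis
    by (simp add: follow_def[abs_def] lessThan_def Ball_def)
qed

text \<open>By \<open>start\<close> and \<open>step\<close> the next target ball always lies inside
  the transition ball, so each of the \<open>L\<close> steps succeeds with probability at least
  \<open>b\<close>, whatever happened before. The clause \<open>x k = \<omega> k\<close> keeps the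
  current position available for the first step.\<close>

lemma emeasure_follow_ge:
  assumes \<omega>: "\<omega> \<in> space (PiM {0..<Suc k} (\<lambda>_. borel))"
    and b: "b \<ge> 0" "\<And>x. b \<le> measure \<mu> (ball x \<eta>) / measure \<mu> UNIV"
    and start: "ball (w 0) \<eta> \<subseteq> ball (f (\<omega> k)) d"
    and step: "\<And>i y. dist (w i) y < \<eta> \<Longrightarrow> ball (w (Suc i)) \<eta> \<subseteq> ball (f y) d"
  shows "emeasure (C (Suc k) L \<omega>)
      {x \<in> space (PiM {0..<Suc k + L} (\<lambda>_. borel)). x k = \<omega> k \<and> follow L \<eta> w (Suc k) x} \<ge> ennreal (b ^ L)"
proof (induction L)
  case 0
  then show ?case
    using \<omega> by (simp add: follow_def)
next
  case (Suc L)
  let ?M = "\<lambda>_::nat. borel :: 'a measure"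
  define E where "E l = {x \<in> space (PiM {0..<Suc k + l} ?M). x k = \<omega> k \<and> follow l \<eta> w (Suc k) x}" for l
  have sets_E: "E l \<in> sets (PiM {0..<Suc k + l} ?M)" for l
  proof -
    note [measurable] = follow_measurable[of "Suc k" l "Suc k + l" \<eta> w]
    have [measurable]: "(\<lambda>x. x k) \<in> measurable (PiM {0..<Suc k + l} ?M) borel"
      by (intro measurable_component_singleton) auto
    have "(\<lambda>x. x k) -` {\<omega> k} \<inter> space (PiM {0..<Suc k + l} ?M) \<in> sets (PiM {0..<Suc k + l} ?M)"
      by (intro measurable_sets[where A=borel]) auto
    moreover have "{x \<in> space (PiM {0..<Suc k + l} ?M). follow l \<eta> w (Suc k) x} \<in> sets (PiM {0..<Suc k + l} ?M)"
      by measurable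
    moreover have "E l = ((\<lambda>x. x k) -` {\<omega> k} \<inter> space (PiM {0..<Suc k + l} ?M))
        \<inter> {x \<in> space (PiM {0..<Suc k + l} ?M). follow l \<eta> w (Suc k) x}"
      by (auto simp: E_def)
    ultimately show ?thesis
      by (simp only: sets.Int)
  qed
  have key: "ennreal b * indicator (E L) x \<le> emeasure (eP (Suc k + L) x) (E (Suc L))"
    if x: "x \<in> space (PiM {0..<Suc k + L} ?M)" for x
  proof (cases "x \<in> E L")
    case True
    then have xk: "x k = \<omega> k" and fl: "follow L \<eta> w (Suc k) x"
      by (simp_all add: E_def)
    \<comment> \<open>Given a history in \<open>E L\<close>, success of the next step depends on the
      new coordinate alone.\<close>
    have "fun_upd x (Suc k + L) y \<in> E (Suc L) \<longleftrightarrow> y \<in> ball (w L) \<eta>" for y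
    proof -
      have "fun_upd x (Suc k + L) y \<in> space (PiM {0..<Suc k + Suc L} ?M)"
        using x by (auto simp: space_PiM PiE_iff extensional_def)
      then show ?thesis
        using xk fl by (auto simp: E_def follow_def less_Suc_eq)
    qed
    then have pre: "fun_upd x (Suc k + L) -` E (Suc L) \<inter> space borel = ball (w L) \<eta>"
      by auto
    have sub: "ball (w L) \<eta> \<subseteq> ball (f (x (k + L))) d"
    \<comment> \<open>The first step leaves from \<open>\<omega> k\<close> itself; later ones leave
      from a point known only to be \<eta>-close to the path.\<close>
    proof (cases L)
      case 0
      then show ?thesis using start xk by simp
    next
      case (Suc l)
      then have "dist (w l) (x (k + L)) < \<eta>"
        using fl by (auto simp: follow_def)
      then show ?thesis using step Suc by simp
    qed
    have "emeasure (eP (Suc k + L) x) (E (Suc L)) = emeasure (rp_kernel \<mu> f d y0 (Suc (k + L)) x) (ball (w L) \<eta>)"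
      using emeasure_eP[OF x, of "E (Suc L)"] sets_E[of "Suc L"] pre by simp
    also have "\<dots> \<ge> ennreal (measure \<mu> (ball (w L) \<eta>) / measure \<mu> UNIV)"
      by (rule emeasure_rp_kernel_ball_ge) (rule sub)
    finally have "emeasure (eP (Suc k + L) x) (E (Suc L)) \<ge> ennreal b"
      using b(2)[of "w L"] ennreal_leI order_trans by blast
    then show ?thesis by (simp add: True)
  qed simp
  have "ennreal (b ^ Suc L) = ennreal b * ennreal (b ^ L)"
    using b(1) by (simp add: ennreal_mult)
  also have "\<dots> \<le> ennreal b * emeasure (C (Suc k) L \<omega>) (E L)"
    using Suc by (intro mult_left_mono) (simp_all add: E_def)
  also have "\<dots> = (\<integral>\<^sup>+x. ennreal b * indicator (E L) x \<partial>C (Suc k) L \<omega>)"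
    by (rule nn_integral_cmult_indicator[symmetric]) (use sets_E[of L] in \<open>simp add: sets_C[OF \<omega>]\<close>)
  also have "\<dots> \<le> (\<integral>\<^sup>+x. emeasure (eP (Suc k + L) x) (E (Suc L)) \<partial>C (Suc k) L \<omega>)"
    by (intro nn_integral_mono key) (simp add: space_C[OF \<omega>])
  also have "\<dots> = emeasure (C (Suc k) (Suc L) \<omega>) (E (Suc L))"
    using emeasure_C_Suc[OF \<omega>, of "E (Suc L)" L] sets_E[of "Suc L"] by simp
  finally show ?case by (simp add: E_def)
qed

text \<open>Time is cut into blocks of length \<open>L\<close>, block \<open>j\<close> occupying the
  times \<open>j * L + 1\<close> to \<open>(j + 1) * L\<close>, since time 0 is the fixed starting
  point. The first \<open>k\<close> blocks are determined by the coordinates up to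
  \<open>k * L\<close>.\<close>

definition avoiders :: "nat \<Rightarrow> real \<Rightarrow> (nat \<Rightarrow> 'a) set \<Rightarrow> nat \<Rightarrow> (nat \<Rightarrow> 'a) set" where
  "avoiders L \<eta> W k = {x \<in> space (PiM {0..<Suc (k * L)} (\<lambda>_. borel)).
     \<forall>j<k. \<forall>w\<in>W. \<not> follow L \<eta> w (Suc (j * L)) x}"

lemma sets_avoiders:
  assumes "finite W"
  shows "avoiders L \<eta> W k \<in> sets (PiM {0..<Suc (k * L)} (\<lambda>_. borel))"
proof -
  let ?N = "PiM {0..<Suc (k * L)} (\<lambda>_. borel)"
  have "Measurable.pred ?N (\<lambda>x. \<forall>j\<in>{..<k}. \<forall>w\<in>W. \<not> follow L \<eta> w (Suc (j * L)) x)"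
  proof (intro pred_intros_finite finite_lessThan assms pred_intros_logic follow_measurable)
    fix j
    assume "j \<in> {..<k}"
    then have "Suc j * L \<le> k * L"
      by (intro mult_le_mono1) auto
    then show "Suc (j * L) + L \<le> Suc (k * L)" by simp
  qed
  moreover have "avoiders L \<eta> W k
      = {x \<in> space ?N. \<forall>j\<in>{..<k}. \<forall>w\<in>W. \<not> follow L \<eta> w (Suc (j * L)) x}"
    by (auto simp: avoiders_def)
  ultimately show ?thesis
    by (simp only: pred_def)
qed

text \<open>Whatever the history before a block, some path of \<open>W\<close> can be entered from
  the current position and is followed through the block with probability at least
  \<open>b ^ L\<close>. Each block thus contributes a factor of at most
  \<open>1 - b ^ L\<close>.\<close>

lemma emeasure_avoiders_le:
  assumes W: "finite W"
    and b: "b \<ge> 0" "b \<le> 1" "\<And>x. b \<le> measure \<mu> (ball x \<eta>) / measure \<mu> UNIV"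
    and start: "\<And>y. \<exists>w\<in>W. ball (w 0) \<eta> \<subseteq> ball (f y) d"
    and step: "\<And>w i y. w \<in> W \<Longrightarrow> dist (w i) y < \<eta> \<Longrightarrow> ball (w (Suc i)) \<eta> \<subseteq> ball (f y) d"
  shows "emeasure (C 0 (Suc (k * L)) (\<lambda>_. undefined)) (avoiders L \<eta> W k) \<le> ennreal ((1 - b ^ L) ^ k)"
proof (induction k)
  case 0
  have u: "(\<lambda>_. undefined) \<in> space (PiM {0..<0::nat} (\<lambda>_. borel :: 'a measure))"
    by simp
  show ?case
    using prob_space.measure_le_1[OF prob_space_C[OF u]] by (simp del: C.simps)
next
  case (Suc k)
  let ?M = "\<lambda>_::nat. borel :: 'a measure"
  let ?u = "\<lambda>_::nat. undefined :: 'a"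
  let ?n = "Suc (k * L)"
  let ?A = "avoiders L \<eta> W"
  have u: "?u \<in> space (PiM {0..<0} ?M)"
    by simp
  have n_eq: "Suc (Suc k * L) = ?n + L" by simp
  have sets_Suc: "?A (Suc k) \<in> sets (PiM {0..<?n + L} ?M)"
    using sets_avoiders[OF W, of L \<eta> "Suc k"] by (simp only: n_eq)
  have pow: "0 \<le> b ^ L" "b ^ L \<le> 1"
    using b by (simp_all add: power_le_one)
  have key: "emeasure (C ?n L x) (?A (Suc k)) \<le> ennreal (1 - b ^ L) * indicator (?A k) x"
    if x: "x \<in> space (PiM {0..<?n} ?M)" for x
  proof (cases "x \<in> ?A k")
    case False
    \<comment> \<open>Avoidance during \<open>Suc k\<close> blocks forces it during the first
      \<open>k\<close>. Forgetting the last block leaves the Dirac measure \<open>C ?n 0 x\<close>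
      at \<open>x\<close>, which gives \<open>?A k\<close> no mass.\<close>
    have "?A (Suc k) \<subseteq> prod_emb {0..<?n + L} ?M {0..<?n + 0} (?A k)"
    proof
      fix y
      assume y: "y \<in> ?A (Suc k)"
      have "restrict y {0..<?n} \<in> ?A k"
      proof -
        have "follow L \<eta> w (Suc (j * L)) (restrict y {0..<?n}) \<longleftrightarrow> follow L \<eta> w (Suc (j * L)) y"
          if "j < k" for w j
        proof -
          have "Suc j * L \<le> k * L"
            using that by (intro mult_le_mono1) auto
          then have "Suc (j * L) + i \<in> {0..<?n}" if "i < L" for i
            using that by auto
          then show ?thesis by (simp add: follow_def)
        qed
        then show ?thesis
          using y by (auto simp: avoiders_def space_PiM)
      qed
      moreover have "y \<in> (\<Pi>\<^sub>E i\<in>{0..<?n + L}. space (?M i))"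
        using y by (simp add: avoiders_def space_PiM add.commute)
      ultimately show "y \<in> prod_emb {0..<?n + L} ?M {0..<?n + 0} (?A k)"
        by (simp add: prod_emb_def)
    qed
    then have "emeasure (C ?n L x) (?A (Suc k))
        \<le> emeasure (C ?n L x) (prod_emb {0..<?n + L} ?M {0..<?n + 0} (?A k))"
      by (rule emeasure_mono)
         (auto simp: sets_C[OF x] intro!: measurable_prod_emb sets_avoiders[OF W])
    also have "\<dots> = emeasure (C ?n 0 x) (?A k)"
      using sets_avoiders[OF W, of L \<eta> k] x by (intro emeasure_C) auto
    also have "\<dots> = 0"
      using False sets_avoiders[OF W, of L \<eta> k] by simp
    finally show ?thesis by simp
  next
    case True
    interpret K: prob_space "C ?n L x" by (rule prob_space_C[OF x])
    obtain w where w: "w \<in> W" "ball (w 0) \<eta> \<subseteq> ball (f (x (k * L))) d"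
      using start by blast
    define E where "E = {y \<in> space (PiM {0..<?n + L} ?M). y (k * L) = x (k * L) \<and> follow L \<eta> w ?n y}"
    have E: "ennreal (b ^ L) \<le> emeasure (C ?n L x) E"
      unfolding E_def by (rule emeasure_follow_ge[OF x b(1,3) w(2) step[OF w(1)]])
    show ?thesis
    \<comment> \<open>Measurability of \<open>E\<close> is read off from its positive measure, so
      \<open>b ^ L = 0\<close> is treated apart; there the bound is the trivial 1.\<close>
    proof (cases "b ^ L = 0")
      case True
      then show ?thesis
        using K.measure_le_1[of "?A (Suc k)"] \<open>x \<in> ?A k\<close>
        by (simp only: diff_zero ennreal_1 indicator_simps mult_1_right)
    next
      case False
      then have "emeasure (C ?n L x) E \<noteq> 0"
        using E pow by (auto simp: ennreal_eq_0_iff)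
      then have sets: "E \<in> K.events"
        using emeasure_neq_0_sets by blast
      have "?A (Suc k) \<subseteq> space (C ?n L x) - E"
        using w(1) by (auto simp: E_def avoiders_def space_C[OF x] add.commute)
      then have "K.prob (?A (Suc k)) \<le> K.prob (space (C ?n L x) - E)"
        using sets by (intro K.finite_measure_mono) auto
      also have "\<dots> \<le> 1 - b ^ L"
        using E sets by (simp add: K.prob_compl K.emeasure_eq_measure)
      finally show ?thesis
        using \<open>x \<in> ?A k\<close> by (simp add: K.emeasure_eq_measure ennreal_leI)
    qed
  qed
  have "emeasure (C 0 (?n + L) ?u) (?A (Suc k)) = (\<integral>\<^sup>+x. emeasure (C ?n L x) (?A (Suc k)) \<partial>C 0 ?n ?u)"
    using emeasure_C_add[OF u, of "?A (Suc k)" ?n L] sets_Suc by simp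
  also have "\<dots> \<le> (\<integral>\<^sup>+x. ennreal (1 - b ^ L) * indicator (?A k) x \<partial>C 0 ?n ?u)"
    by (intro nn_integral_mono key) (simp add: space_C[OF u] del: C.simps)
  also have "\<dots> = ennreal (1 - b ^ L) * emeasure (C 0 ?n ?u) (?A k)"
    using sets_avoiders[OF W, of L \<eta> k] by (intro nn_integral_cmult_indicator) (simp add: sets_C[OF u] del: C.simps)
  also have "\<dots> \<le> ennreal (1 - b ^ L) * ennreal ((1 - b ^ L) ^ k)"
    by (intro mult_left_mono Suc) simp
  also have "\<dots> = ennreal ((1 - b ^ L) ^ Suc k)"
    using pow by (simp add: ennreal_mult)
  finally show ?case by (simp only: n_eq)
qed

text \<open>A shadowed pseudotrajectory follows no path of \<open>W\<close> at any time, so it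
  avoids them in the first \<open>k\<close> blocks for every \<open>k\<close>, and the bound
  \<open>(1 - b ^ L) ^ k\<close> tends to 0.\<close>

lemma p_shadow_eq_0:
  assumes W: "finite W"
    and b: "b > 0" "b \<le> 1" "\<And>x. b \<le> measure \<mu> (ball x \<eta>) / measure \<mu> UNIV"
    and start: "\<And>y. \<exists>w\<in>W. ball (w 0) \<eta> \<subseteq> ball (f y) d"
    and step: "\<And>w i y. w \<in> W \<Longrightarrow> dist (w i) y < \<eta> \<Longrightarrow> ball (w (Suc i)) \<eta> \<subseteq> ball (f y) d"
    and bad: "\<And>y w n. y \<in> Sh f y0 d \<epsilon> \<Longrightarrow> w \<in> W \<Longrightarrow> \<not> follow L \<eta> w n y"
  shows "p_shadow \<mu> f y0 d \<epsilon> = 0"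
proof -
  interpret lim: prob_space PF.lim by (rule prob_space_lim)
  let ?M = "\<lambda>_::nat. borel :: 'a measure"
  have pow: "0 < b ^ L" "b ^ L \<le> 1"
    using b by (simp_all add: power_le_one)
  have le: "p_shadow \<mu> f y0 d \<epsilon> \<le> (1 - b ^ L) ^ k" for k
  proof -
    let ?A = "avoiders L \<eta> W k"
    have sub: "Sh f y0 d \<epsilon> \<subseteq> PF.emb UNIV {0..<Suc (k * L)} ?A"
    proof
      fix y
      assume y: "y \<in> Sh f y0 d \<epsilon>"
      have "\<not> follow L \<eta> w (Suc (j * L)) (restrict y {0..<Suc (k * L)})" if "j < k" "w \<in> W" for j w
      proof -
        have "Suc j * L \<le> k * L"
          using that by (intro mult_le_mono1) auto
        then have "Suc (j * L) + i \<in> {0..<Suc (k * L)}" if "i < L" for i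
          using that by auto
        then show ?thesis
          using bad[OF y that(2), of "Suc (j * L)"] by (simp add: follow_def)
      qed
      then show "y \<in> PF.emb UNIV {0..<Suc (k * L)} ?A"
        by (auto simp: prod_emb_def avoiders_def space_PiM)
    qed
    have "emeasure (C 0 (Suc (k * L)) (\<lambda>_. undefined)) ?A \<le> ennreal ((1 - b ^ L) ^ k)"
      by (rule emeasure_avoiders_le) (fact W less_imp_le[OF b(1)] b start step)+
    then have "ennreal (measure PF.lim (PF.emb UNIV {0..<Suc (k * L)} ?A)) \<le> ennreal ((1 - b ^ L) ^ k)"
      unfolding lim.emeasure_eq_measure[symmetric] emeasure_lim_initial[OF sets_avoiders[OF W]] .
    then have "measure PF.lim (PF.emb UNIV {0..<Suc (k * L)} ?A) \<le> (1 - b ^ L) ^ k"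
      using pow by (simp add: ennreal_le_iff)
    moreover have "p_shadow \<mu> f y0 d \<epsilon> \<le> measure PF.lim (PF.emb UNIV {0..<Suc (k * L)} ?A)"
      unfolding p_shadow_def rp_measure_eq
      by (rule lim.finite_measure_mono[OF sub]) (auto intro!: measurable_prod_emb sets_avoiders[OF W])
    ultimately show ?thesis by simp
  qed
  have "(\<lambda>k. (1 - b ^ L) ^ k) \<longlonglongrightarrow> 0"
    using pow by (intro LIMSEQ_power_zero) simp
  then have "p_shadow \<mu> f y0 d \<epsilon> \<le> 0"
    by (rule LIMSEQ_le_const) (use le in blast)
  then show ?thesis
    by (simp add: p_shadow_def measure_le_0_iff)
qed

section \<open>Almost every path of the chain is a pseudotrajectory from the starting point\<close>

lemma AE_lim_step:
  assumes A: "A \<in> sets (PiM {0..<Suc m} (\<lambda>_. borel))"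
    and step: "\<And>x. x \<in> space (PiM {0..<m} (\<lambda>_. borel)) \<Longrightarrow>
      emeasure (rp_kernel \<mu> f d y0 m x) {z. fun_upd x m z \<in> A} = 1"
  shows "AE y in PF.lim. restrict y {0..<Suc m} \<in> A"
proof -
  interpret lim: prob_space PF.lim by (rule prob_space_lim)
  let ?M = "\<lambda>_::nat. borel :: 'a measure"
  let ?u = "\<lambda>_::nat. undefined :: 'a"
  have u: "?u \<in> space (PiM {0..<0} ?M)"
    by simp
  interpret K: prob_space "C 0 m ?u" by (rule prob_space_C[OF u])
  have "emeasure (eP m x) A = 1" if "x \<in> space (PiM {0..<m} ?M)" for x
    using emeasure_eP[OF that A] step[OF that] by (simp add: vimage_def)
  then have "(\<integral>\<^sup>+x. emeasure (eP m x) A \<partial>C 0 m ?u) = (\<integral>\<^sup>+x. 1 \<partial>C 0 m ?u)"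
    by (intro nn_integral_cong) (simp add: space_C[OF u])
  then have "emeasure (C 0 (Suc m) ?u) A = (\<integral>\<^sup>+x. 1 \<partial>C 0 m ?u)"
    using emeasure_C_Suc[OF u, of A m] A by (simp del: C.simps)
  then have "emeasure PF.lim (PF.emb UNIV {0..<Suc m} A) = 1"
    using emeasure_lim_initial[OF A] by (simp add: K.emeasure_space_1)
  moreover have "PF.emb UNIV {0..<Suc m} A \<in> lim.events"
    using A by (auto intro!: measurable_prod_emb)
  ultimately have "AE y in PF.lim. y \<in> PF.emb UNIV {0..<Suc m} A"
    by (simp add: lim.prob_eq_1[symmetric] lim.emeasure_eq_measure)
  then show ?thesis
    by eventually_elim (simp add: prod_emb_def)
qed

text \<open>The start and each single step satisfy their condition almost surely, and there are
  countably many conditions. This gives shadowing probability one once every pseudotrajectory is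
  shadowed.\<close>

lemma measure_Omega_pt: "measure (rp_measure \<mu> f d y0) (Omega_pt f y0 d) = 1"
proof -
  interpret lim: prob_space PF.lim by (rule prob_space_lim)
  let ?M = "\<lambda>_::nat. borel :: 'a measure"
  have coord: "(\<lambda>y. y i) \<in> measurable (PiM I ?M) borel" if "i \<in> I" for i I
    using that by (rule measurable_component_singleton)
  have dist: "(\<lambda>y. dist (y (Suc n)) (f (y n))) \<in> borel_measurable (PiM I ?M)"
    if "n \<in> I" "Suc n \<in> I" for n I
  proof -
    note [measurable] = coord[OF that(1)] coord[OF that(2)]
    show ?thesis
      by (rule borel_measurable_dist_compact[OF compact_M]) measurable
  qed
  have start: "Measurable.pred (PiM I ?M) (\<lambda>y. y 0 = y0)" if "0 \<in> I" for I
    using measurable_sets[OF coord[OF that], of "{y0}"]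
    by (simp add: pred_def vimage_def Int_def conj_commute)
  have "AE y in PF.lim. restrict y {0..<Suc 0} \<in> {y \<in> space (PiM {0..<Suc 0} ?M). y 0 = y0}"
  proof (rule AE_lim_step)
    show "{y \<in> space (PiM {0..<Suc 0} ?M). y 0 = y0} \<in> sets (PiM {0..<Suc 0} ?M)"
      using start[of "{0..<Suc 0}"] by (simp add: pred_def)
    fix x
    assume "x \<in> space (PiM {0..<0} ?M)"
    then have "{z. fun_upd x 0 z \<in> {y \<in> space (PiM {0..<Suc 0} ?M). y 0 = y0}} = {y0}"
      by (auto simp: space_PiM PiE_iff extensional_def)
    then show "emeasure (rp_kernel \<mu> f d y0 0 x)
        {z. fun_upd x 0 z \<in> {y \<in> space (PiM {0..<Suc 0} ?M). y 0 = y0}} = 1"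
      by (simp add: rp_kernel_def)
  qed
  then have AE0: "AE y in PF.lim. y 0 = y0"
    by eventually_elim simp
  have AEn: "AE y in PF.lim. dist (y (Suc n)) (f (y n)) \<le> d" for n
  proof -
    let ?S = "{y \<in> space (PiM {0..<Suc (Suc n)} ?M). dist (y (Suc n)) (f (y n)) \<le> d}"
    have "AE y in PF.lim. restrict y {0..<Suc (Suc n)} \<in> ?S"
    proof (rule AE_lim_step)
      note [measurable] = dist[of n "{0..<Suc (Suc n)}"]
      show "?S \<in> sets (PiM {0..<Suc (Suc n)} ?M)"
        by measurable
      fix x
      assume "x \<in> space (PiM {0..<Suc n} ?M)"
      then have eq: "{z. fun_upd x (Suc n) z \<in> ?S} = cball (f (x n)) d"
        by (auto simp: space_PiM PiE_iff extensional_def dist_commute)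
      \<comment> \<open>The chain jumps within the open ball while a pseudotrajectory allows
        distance exactly \<open>d\<close>; the conditional mass is therefore a quotient of equal
        numbers.\<close>
      have "ball (f (x n)) d \<inter> cball (f (x n)) d = ball (f (x n)) d"
        by auto
      then show "emeasure (rp_kernel \<mu> f d y0 (Suc n) x) {z. fun_upd x (Suc n) z \<in> ?S} = 1"
        unfolding eq using emeasure_ball_pos[of "f (x n)"]
        by (simp add: emeasure_rp_kernel_Suc ennreal_divide_self less_top[symmetric] mu.emeasure_finite)
    qed
    then show ?thesis
      by eventually_elim simp
  qed
  have "AE y in PF.lim. \<forall>n. dist (y (Suc n)) (f (y n)) \<le> d"
    using AEn by (simp add: AE_all_countable)
  with AE0 have "AE y in PF.lim. y \<in> Omega_pt f y0 d"
    by eventually_elim (simp add: Omega_pt_def pseudotraj_def)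
  moreover have "Omega_pt f y0 d \<in> lim.events"
  proof -
    note [measurable] = dist[of _ UNIV, simplified] start[of UNIV, simplified]
    have "{y \<in> space (PiM UNIV ?M). y 0 = y0 \<and> (\<forall>n. dist (y (Suc n)) (f (y n)) \<le> d)} \<in> sets (PiM UNIV ?M)"
      by measurable
    then show ?thesis
      by (simp add: Omega_pt_def pseudotraj_def space_PiM)
  qed
  ultimately show ?thesis
    unfolding rp_measure_eq using lim.prob_eq_1 by blast
qed

end

section \<open>The dichotomy between shadowing and absolute non-shadowability\<close>

theorem theorem1:
  fixes \<mu> :: "'a::metric_space measure" and f :: "'a \<Rightarrow> 'a"
  assumes compact_M: "compact (UNIV :: 'a set)"
    and borel_mu: "sets \<mu> = sets borel"
    and finite_mu: "finite_measure \<mu>"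
    and full_support: "\<And>U. open U \<Longrightarrow> U \<noteq> {} \<Longrightarrow> emeasure \<mu> U > 0"
    and homeo: "\<exists>g. homeomorphism UNIV UNIV f g"
    and transitive: "\<exists>r. closure {(f ^^ n) r | n. True} = UNIV"
  shows "shadowing_property f \<longleftrightarrow> \<not> absolutely_not_shadowable \<mu> f"
proof -
  have cont: "continuous_on UNIV f" and surj: "surj f"
    using homeo by (auto simp: homeomorphism_def)
  obtain r where r: "closure {(f ^^ n) r | n. True} = UNIV"
    using transitive by blast
  have rp: "random_pseudotrajectory \<mu> f d" if "d > 0" for d
    by (rule random_pseudotrajectory.intro[OF compact_M borel_mu finite_mu full_support cont that])
  have "\<not> absolutely_not_shadowable \<mu> f" if shadowing: "shadowing_property f"
  proof
    assume "absolutely_not_shadowable \<mu> f"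
    then obtain \<epsilon> where "\<epsilon> > 0" and p: "\<And>y0 d. d > 0 \<Longrightarrow> p_shadow \<mu> f y0 d \<epsilon> = 0"
      unfolding absolutely_not_shadowable_def by blast
    obtain d where "d > 0" and d: "\<And>y. pseudotraj f d y \<Longrightarrow> shadowed f \<epsilon> y"
      using shadowing \<open>\<epsilon> > 0\<close> unfolding shadowing_property_def by blast
    then have "Sh f r d \<epsilon> = Omega_pt f r d"
      by (auto simp: Sh_def Omega_pt_def)
    then show False
      using p[OF \<open>d > 0\<close>, of r] random_pseudotrajectory.measure_Omega_pt[OF rp[OF \<open>d > 0\<close>], of r]
      by (simp add: p_shadow_def)
  qed
  moreover have "absolutely_not_shadowable \<mu> f" if not_shadowing: "\<not> shadowing_property f"
  proof -
    obtain \<epsilon> where "\<epsilon> > 0" and \<epsilon>: "\<And>\<delta>. \<delta> > 0 \<Longrightarrow> \<exists>z. pseudotraj f \<delta> z \<and> \<not> shadowed f \<epsilon> z"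
      using not_shadowing unfolding shadowing_property_def by blast
    \<comment> \<open>Half of \<epsilon> is reserved for the distance between the random walk and
      the bad path it follows.\<close>
    have "p_shadow \<mu> f y0 d (\<epsilon> / 2) = 0" if "d > 0" for y0 d
    proof -
      interpret random_pseudotrajectory \<mu> f d y0 by (rule rp[OF \<open>d > 0\<close>])
      have "d / 2 > 0" using \<open>d > 0\<close> by simp
      obtain z where z: "pseudotraj f (d / 2) z" "\<not> shadowed f \<epsilon> z"
        using \<epsilon>[OF \<open>d / 2 > 0\<close>] by blast
      obtain W L where W: "finite W" "\<And>x. \<exists>w\<in>W. dist x (w 0) < d / 2"
        "\<And>w i. w \<in> W \<Longrightarrow> dist (f (w i)) (w (Suc i)) \<le> d / 2"
        "\<And>w x. w \<in> W \<Longrightarrow> \<exists>i<L. dist (w i) ((f ^^ i) x) > \<epsilon>"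
        using bad_paths[OF compact_M cont surj r \<open>d / 2 > 0\<close> z] by blast
      have "uniformly_continuous_on UNIV f"
        by (rule compact_uniformly_continuous[OF cont compact_M])
      then obtain \<delta> where "\<delta> > 0" and \<delta>: "\<And>x y. dist x y < \<delta> \<Longrightarrow> dist (f x) (f y) < d / 4"
        unfolding uniformly_continuous_on_def using \<open>d > 0\<close>
        by (metis UNIV_I zero_less_divide_iff zero_less_numeral)
      \<comment> \<open>A step may deviate by \<open>d / 4\<close> through \<open>f\<close>, by
        \<open>d / 2\<close> along the path and by \<eta> at the target, in total less than
        \<open>d\<close>. The bound \<open>\<epsilon> / 2\<close> lets closeness to a bad path
        contradict shadowing.\<close>
      define \<eta> where "\<eta> = min \<delta> (min (d / 4) (\<epsilon> / 2))"
      have \<eta>: "\<eta> > 0" "\<eta> \<le> \<delta>" "\<eta> \<le> d / 4" "\<eta> \<le> \<epsilon> / 2"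
        using \<open>\<delta> > 0\<close> \<open>d > 0\<close> \<open>\<epsilon> > 0\<close> by (auto simp: \<eta>_def)
      obtain c where c: "c > 0" "\<And>x. c \<le> measure \<mu> (ball x \<eta>)"
        using compact_ball_measure_lower_bound[OF compact_M borel_mu finite_mu full_support \<eta>(1)] by blast
      have c_le: "c \<le> measure \<mu> UNIV"
        using c(2)[of undefined] mu.bounded_measure[of "ball undefined \<eta>"]
        by (simp add: sets_eq_imp_space_eq[OF borel_mu])
      show ?thesis
      proof (rule p_shadow_eq_0[OF W(1)])
        show "0 < c / measure \<mu> UNIV" "c / measure \<mu> UNIV \<le> 1"
          using c(1) c_le by auto
        show "c / measure \<mu> UNIV \<le> measure \<mu> (ball x \<eta>) / measure \<mu> UNIV" for x
          by (intro divide_right_mono c(2)) simp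
        show "\<exists>w\<in>W. ball (w 0) \<eta> \<subseteq> ball (f y) d" for y
        proof -
          obtain w where w: "w \<in> W" "dist (f y) (w 0) < d / 2" using W(2) by blast
          have "dist (f y) u < d" if "dist (w 0) u < \<eta>" for u
            using dist_triangle[of "f y" u "w 0"] w(2) that \<eta>(3) \<open>d > 0\<close> by linarith
          then have "ball (w 0) \<eta> \<subseteq> ball (f y) d" by auto
          with w(1) show ?thesis by blast
        qed
        show "ball (w (Suc i)) \<eta> \<subseteq> ball (f y) d" if "w \<in> W" "dist (w i) y < \<eta>" for w i y
        proof -
          have "dist (f (w i)) (f y) < d / 4"
            using \<delta> that(2) \<eta>(2) by simp
          then have "dist (f y) u < d" if "dist (w (Suc i)) u < \<eta>" for u
            using dist_triangle[of "f y" u "w (Suc i)"] dist_triangle3[of "f y" "w (Suc i)" "f (w i)"]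
              W(3)[OF \<open>w \<in> W\<close>, of i] that \<eta>(3) by linarith
          then show ?thesis by (auto simp: subset_eq)
        qed
        show "\<not> follow L \<eta> w n y" if "y \<in> Sh f y0 d (\<epsilon> / 2)" "w \<in> W" for y w n
        proof
          assume fl: "follow L \<eta> w n y"
          obtain x0 where x0: "\<And>k. dist (y k) ((f ^^ k) x0) \<le> \<epsilon> / 2"
            using \<open>y \<in> Sh f y0 d (\<epsilon> / 2)\<close> by (auto simp: Sh_def shadowed_def)
          \<comment> \<open>A point \<open>x0\<close> shadowing \<open>y\<close> yields
            \<open>(f ^^ n) x0\<close>, which would stay within \<epsilon> of the bad path followed
            from time \<open>n\<close>.\<close>
          obtain i where i: "i < L" "dist (w i) ((f ^^ i) ((f ^^ n) x0)) > \<epsilon>"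
            using W(4)[OF \<open>w \<in> W\<close>] by blast
          have "dist (w i) (y (n + i)) < \<eta>"
            using fl i(1) by (simp add: follow_def)
          moreover have "dist (y (n + i)) ((f ^^ i) ((f ^^ n) x0)) \<le> \<epsilon> / 2"
            using x0[of "n + i"] by (simp add: funpow_add add.commute[of n])
          ultimately show False
            using i(2) \<eta>(4) dist_triangle[of "w i" "(f ^^ i) ((f ^^ n) x0)" "y (n + i)"] by linarith
        qed
      qed
    qed
    then show ?thesis
      unfolding absolutely_not_shadowable_def using \<open>\<epsilon> > 0\<close> by (intro exI[of _ "\<epsilon> / 2"]) auto
  qed
  ultimately show ?thesis by blast
qed

end
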